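(* Let $R\in\mathbb{R}^{N\times d}$ be a real matrix with singular value decomposition $R=U\Sigma V^T$, where $\Sigma=\mathrm{diag}(\sigma_1,\sigma_2,\dots,\sigma_k)$ with $\sigma_1\ge\sigma_2\ge\dots\ge\sigma_k\ge 0$. Let $\Sigma'=\mathrm{diag}(\sigma_1,0,\dots,0)$ (of the same size as $\Sigma$) and $\bar R=U\Sigma'V^T$. Then $\bar R$ is an optimal rank-one approximation of $R$, in the sense that $$\|\bar R-R\|_F^2=\min_{b\in\mathbb{R}^N,\;c\in\mathbb{R}^d}\|bc^T-R\|_F^2 .$$
   Context: $\|\cdot\|_F$ denotes the Frobenius norm of a matrix. The singular value decomposition is in the usual sense, with singular values listed in descending order: $k=\min(N,d)$, $U\in\mathbb{R}^{N\times k}$ and $V\in\mathbb{R}^{d\times k}$ have orthonormal columns, and $\Sigma$ is the $k\times k$ diagonal matrix of singular values. *)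

theory Defs
  imports Complex_Main "Jordan_Normal_Form.Matrix"
begin

text \<open>
  The matrices are those of the Jordan Normal Form entry, because the inner dimension
  of the decomposition is the minimum of the two outer ones.
\<close>

definition frobenius_norm :: "real mat \<Rightarrow> real" where
  "frobenius_norm A = sqrt (\<Sum>i<dim_row A. \<Sum>j<dim_col A. (A $$ (i, j))\<^sup>2)"

definition orthonormal_columns :: "real mat \<Rightarrow> bool" where
  "orthonormal_columns A \<longleftrightarrow>
     (\<forall>i<dim_col A. \<forall>j<dim_col A. col A i \<bullet> col A j = (if i = j then 1 else 0))"

text \<open>
  The singular values are indexed from 0, so \<open>\<sigma> 0\<close> is the largest one.
  Only the values \<open>\<sigma> i\<close> with \<open>i < k\<close> matter.
\<close>

definition is_svd :: "real mat \<Rightarrow> real mat \<Rightarrow> (nat \<Rightarrow> real) \<Rightarrow> real mat \<Rightarrow> bool" where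
  "is_svd R U \<sigma> V \<longleftrightarrow>
     (let k = min (dim_row R) (dim_col R) in
        U \<in> carrier_mat (dim_row R) k \<and> orthonormal_columns U \<and>
        V \<in> carrier_mat (dim_col R) k \<and> orthonormal_columns V \<and>
        (\<forall>i j. i \<le> j \<longrightarrow> j < k \<longrightarrow> \<sigma> j \<le> \<sigma> i) \<and>
        (\<forall>i<k. 0 \<le> \<sigma> i) \<and>
        R = U * mat_diag k \<sigma> * transpose_mat V)"

text \<open>The rank-one product \<open>b c\<^sup>T\<close>, with vectors read as one-column matrices.\<close>

definition outer_prod :: "real vec \<Rightarrow> real vec \<Rightarrow> real mat" where
  "outer_prod b c =
     mat_of_cols (dim_vec b) [b] * transpose_mat (mat_of_cols (dim_vec c) [c])"

end

theory Submission
  imports Defs "HOL-Analysis.L2_Norm"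
begin

text \<open>
  The matrices \<open>u\<^sub>l v\<^sub>l\<^sup>T\<close> are orthonormal for the Frobenius inner product, so with
  \<open>\<beta>\<^sub>l = \<langle>b, u\<^sub>l\<rangle>\<close> and \<open>\<gamma>\<^sub>l = \<langle>c, v\<^sub>l\<rangle>\<close> the squared distance of \<open>b c\<^sup>T\<close> to \<open>R\<close> is
  \<open>\<bar>b\<bar>\<^sup>2 \<bar>c\<bar>\<^sup>2 - 2 (\<Sum>l. \<sigma>\<^sub>l \<beta>\<^sub>l \<gamma>\<^sub>l) + (\<Sum>l. \<sigma>\<^sub>l\<^sup>2)\<close>. By Cauchy-Schwarz and Bessel the middle sum
  is at most \<open>\<sigma>\<^sub>0 \<bar>b\<bar> \<bar>c\<bar>\<close>, and completing the square in \<open>\<bar>b\<bar> \<bar>c\<bar>\<close> bounds the distance below by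
  \<open>(\<Sum>l. \<sigma>\<^sub>l\<^sup>2) - \<sigma>\<^sub>0\<^sup>2\<close>, the value attained at the truncated decomposition.
\<close>

text \<open>The coordinate type is left arbitrary so that one notion covers vectors, indexed by
  rows, and matrices under the Frobenius inner product, indexed by pairs.\<close>

definition orthonormal_family :: "'i set \<Rightarrow> 'l set \<Rightarrow> ('l \<Rightarrow> 'i \<Rightarrow> real) \<Rightarrow> bool" where
  "orthonormal_family I L w \<longleftrightarrow>
     (\<forall>l\<in>L. \<forall>m\<in>L. (\<Sum>i\<in>I. w l i * w m i) = (if l = m then 1 else 0))"

text \<open>Expanding the square leaves a double sum over \<open>L\<close>, which orthonormality
  collapses to its diagonal. The identity serves for Bessel and for both Frobenius
  distances.\<close>

lemma sum_square_diff_orthonormal: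
  assumes "finite L" and w: "orthonormal_family I L w"
  shows "(\<Sum>i\<in>I. (f i - (\<Sum>l\<in>L. a l * w l i))\<^sup>2)
    = (\<Sum>i\<in>I. (f i)\<^sup>2) - 2 * (\<Sum>l\<in>L. a l * (\<Sum>i\<in>I. f i * w l i)) + (\<Sum>l\<in>L. (a l)\<^sup>2)"
proof -
  have "(\<Sum>i\<in>I. f i * (\<Sum>l\<in>L. a l * w l i)) = (\<Sum>l\<in>L. a l * (\<Sum>i\<in>I. f i * w l i))"
    by (simp add: sum_distrib_left sum.swap[of _ L I] mult.left_commute)
  moreover have "(\<Sum>i\<in>I. (\<Sum>l\<in>L. a l * w l i)\<^sup>2) = (\<Sum>l\<in>L. (a l)\<^sup>2)"
  proof -
    have "(\<Sum>i\<in>I. (\<Sum>l\<in>L. a l * w l i)\<^sup>2)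
        = (\<Sum>i\<in>I. \<Sum>l\<in>L. \<Sum>m\<in>L. a l * a m * (w l i * w m i))"
      by (simp add: power2_eq_square sum_product mult_ac)
    also have "\<dots> = (\<Sum>l\<in>L. \<Sum>i\<in>I. \<Sum>m\<in>L. a l * a m * (w l i * w m i))"
      by (rule sum.swap)
    also have "\<dots> = (\<Sum>l\<in>L. \<Sum>m\<in>L. \<Sum>i\<in>I. a l * a m * (w l i * w m i))"
      by (rule sum.cong[OF refl], rule sum.swap)
    also have "\<dots> = (\<Sum>l\<in>L. \<Sum>m\<in>L. a l * a m * (\<Sum>i\<in>I. w l i * w m i))"
      by (simp only: sum_distrib_left)
    also have "\<dots> = (\<Sum>l\<in>L. \<Sum>m\<in>L. if l = m then a l * a m else 0)"
      using w by (intro sum.cong refl) (simp add: orthonormal_family_def)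
    also have "\<dots> = (\<Sum>l\<in>L. (a l)\<^sup>2)"
      using \<open>finite L\<close> by (simp add: sum.delta' power2_eq_square)
    finally show ?thesis .
  qed
  moreover have "(\<Sum>i\<in>I. 2 * f i * g i) = 2 * (\<Sum>i\<in>I. f i * g i)" for g
    by (simp add: sum_distrib_left mult.assoc)
  ultimately show ?thesis
    by (simp only: power2_diff sum.distrib sum_subtractf)
qed

lemma Bessel_inequality_finite:
  assumes "finite L" and "orthonormal_family I L w"
  shows "(\<Sum>l\<in>L. (\<Sum>i\<in>I. f i * w l i)\<^sup>2) \<le> (\<Sum>i\<in>I. (f i)\<^sup>2)"
proof -
  \<comment> \<open>The coefficients are those of the orthogonal projection of \<open>f\<close>;
    with them the cross term is twice the sum of squares.\<close>
  have "0 \<le> (\<Sum>i\<in>I. (f i - (\<Sum>l\<in>L. (\<Sum>j\<in>I. f j * w l j) * w l i))\<^sup>2)"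
    by (intro sum_nonneg) simp
  then show ?thesis
    unfolding sum_square_diff_orthonormal[OF assms] by (simp add: power2_eq_square)
qed

text \<open>The inner product of two tensors factors into the inner products of their
  components.\<close>

lemma orthonormal_family_tensor:
  assumes "orthonormal_family I L u" and "orthonormal_family J L v"
  shows "orthonormal_family (I \<times> J) L (\<lambda>l (i, j). u l i * v l j)"
proof -
  have "(\<Sum>p\<in>I \<times> J. (case p of (i, j) \<Rightarrow> u l i * v l j) * (case p of (i, j) \<Rightarrow> u m i * v m j))
      = (\<Sum>i\<in>I. u l i * u m i) * (\<Sum>j\<in>J. v l j * v m j)" for l m
    by (simp add: sum_product sum.cartesian_product case_prod_unfold mult_ac)
  with assms show ?thesis
    by (simp add: orthonormal_family_def)
qed

text \<open>Cauchy-Schwarz over \<open>L\<close> bounds the sum of products of coefficients, and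
  Bessel bounds each of the two coefficient norms.\<close>

lemma weighted_coefficients_le:
  assumes "finite L" and u: "orthonormal_family I L u" and v: "orthonormal_family J L v"
    and s: "\<And>l. l \<in> L \<Longrightarrow> 0 \<le> s l \<and> s l \<le> M" and "0 \<le> M"
  shows "(\<Sum>l\<in>L. s l * ((\<Sum>i\<in>I. b i * u l i) * (\<Sum>j\<in>J. c j * v l j)))
    \<le> M * (L2_set b I * L2_set c J)"
proof -
  define \<beta> where "\<beta> l = (\<Sum>i\<in>I. b i * u l i)" for l
  define \<gamma> where "\<gamma> l = (\<Sum>j\<in>J. c j * v l j)" for l
  have "L2_set \<beta> L \<le> L2_set b I" and "L2_set \<gamma> L \<le> L2_set c J"
    using Bessel_inequality_finite[OF \<open>finite L\<close> u] Bessel_inequality_finite[OF \<open>finite L\<close> v]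
    by (simp_all add: L2_set_def \<beta>_def \<gamma>_def)
  then have "L2_set \<beta> L * L2_set \<gamma> L \<le> L2_set b I * L2_set c J"
    by (intro mult_mono) auto
  then have "(\<Sum>l\<in>L. \<bar>\<beta> l\<bar> * \<bar>\<gamma> l\<bar>) \<le> L2_set b I * L2_set c J"
    using L2_set_mult_ineq[of \<beta> \<gamma> L] by linarith
  then have "M * (\<Sum>l\<in>L. \<bar>\<beta> l\<bar> * \<bar>\<gamma> l\<bar>) \<le> M * (L2_set b I * L2_set c J)"
    using \<open>0 \<le> M\<close> by (rule mult_left_mono)
  moreover have "(\<Sum>l\<in>L. s l * (\<beta> l * \<gamma> l)) \<le> M * (\<Sum>l\<in>L. \<bar>\<beta> l\<bar> * \<bar>\<gamma> l\<bar>)"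
    unfolding sum_distrib_left
  proof (rule sum_mono)
    fix l assume "l \<in> L"
    \<comment> \<open>The product of coefficients may be negative, so absolute values come in before
      \<open>s l\<close> is raised to \<open>M\<close>.\<close>
    have "s l * (\<beta> l * \<gamma> l) \<le> s l * (\<bar>\<beta> l\<bar> * \<bar>\<gamma> l\<bar>)"
      using s[OF \<open>l \<in> L\<close>] by (intro mult_left_mono) (simp_all flip: abs_mult)
    also have "\<dots> \<le> M * (\<bar>\<beta> l\<bar> * \<bar>\<gamma> l\<bar>)"
      using s[OF \<open>l \<in> L\<close>] by (intro mult_right_mono) simp_all
    finally show "s l * (\<beta> l * \<gamma> l) \<le> M * (\<bar>\<beta> l\<bar> * \<bar>\<gamma> l\<bar>)" .
  qed
  ultimately show ?thesis
    unfolding \<beta>_def \<gamma>_def by linarith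
qed

lemma orthonormal_family_columns:
  assumes "A \<in> carrier_mat n k" and "orthonormal_columns A"
  shows "orthonormal_family {..<n} {..<k} (\<lambda>l i. A $$ (i, l))"
  using assms
  by (auto simp: orthonormal_family_def orthonormal_columns_def scalar_prod_def atLeast0LessThan)

lemma index_mult_mat_diag_transpose:
  fixes U V :: "real mat"
  assumes "U \<in> carrier_mat n k" and "V \<in> carrier_mat m k" and "i < n" and "j < m"
  shows "(U * mat_diag k s * transpose_mat V) $$ (i, j)
    = (\<Sum>l<k. s l * (U $$ (i, l) * V $$ (j, l)))"
proof -
  have "U * mat_diag k s = mat n k (\<lambda>(i, j). U $$ (i, j) * s j)"
    using assms(1) by (rule mat_diag_mult_right)
  with assms show ?thesis
    by (simp add: scalar_prod_def atLeast0LessThan mult_ac)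
qed

lemma outer_prod_carrier:
  assumes "b \<in> carrier_vec n" and "c \<in> carrier_vec m"
  shows "outer_prod b c \<in> carrier_mat n m"
  using assms by (intro carrier_matI) (simp_all add: outer_prod_def)

lemma index_outer_prod:
  assumes "i < dim_vec b" and "j < dim_vec c"
  shows "outer_prod b c $$ (i, j) = b $ i * c $ j"
  using assms by (simp add: outer_prod_def scalar_prod_def mat_of_cols_def)

lemma frobenius_norm_diff_square:
  assumes "A \<in> carrier_mat n m" and "B \<in> carrier_mat n m"
  shows "(frobenius_norm (A - B))\<^sup>2 = (\<Sum>(i, j)\<in>{..<n} \<times> {..<m}. (A $$ (i, j) - B $$ (i, j))\<^sup>2)"
  using assms by (simp add: frobenius_norm_def sum_nonneg sum.cartesian_product case_prod_unfold)

theorem theorem1: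
  fixes N d k :: nat and R U V R_bar :: "real mat" and \<sigma> :: "nat \<Rightarrow> real"
  assumes "1 \<le> N" and "1 \<le> d"
    and "k = min N d"
    and "R \<in> carrier_mat N d"
    and "is_svd R U \<sigma> V"
    and "R_bar = U * mat_diag k (\<lambda>i. if i = 0 then \<sigma> 0 else 0) * transpose_mat V"
  shows "(\<exists>b\<in>carrier_vec N. \<exists>c\<in>carrier_vec d.
            (frobenius_norm (R_bar - R))\<^sup>2 = (frobenius_norm (outer_prod b c - R))\<^sup>2) \<and>
         (\<forall>b\<in>carrier_vec N. \<forall>c\<in>carrier_vec d.
            (frobenius_norm (R_bar - R))\<^sup>2 \<le> (frobenius_norm (outer_prod b c - R))\<^sup>2)"
proof -
  \<comment> \<open>Positivity of \<open>k\<close> makes \<open>\<sigma> 0\<close> a genuine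
    singular value and column 0 available in both factors.\<close>
  have k: "0 < k" using assms(1-3) by simp
  have U: "U \<in> carrier_mat N k" "orthonormal_columns U"
    and V: "V \<in> carrier_mat d k" "orthonormal_columns V"
    and \<sigma>_mono: "\<And>i j. i \<le> j \<Longrightarrow> j < k \<Longrightarrow> \<sigma> j \<le> \<sigma> i"
    and \<sigma>_nonneg: "\<And>i. i < k \<Longrightarrow> 0 \<le> \<sigma> i"
    and R: "R = U * mat_diag k \<sigma> * transpose_mat V"
    using assms(3-5) by (auto simp: is_svd_def Let_def)
  have R_index: "R $$ (i, j) = (\<Sum>l<k. \<sigma> l * (U $$ (i, l) * V $$ (j, l)))"
    if "i < N" "j < d" for i j
    unfolding R using index_mult_mat_diag_transpose[OF U(1) V(1) that] .
  \<comment> \<open>\<open>w l\<close> is the rank-one matrix of the \<open>l\<close>-th singular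
    pair, read as a function on index pairs.\<close>
  define w where "w = (\<lambda>l (i, j). U $$ (i, l) * V $$ (j, l))"
  note orth_U = orthonormal_family_columns[OF U]
  note orth_V = orthonormal_family_columns[OF V]
  have orth_w: "orthonormal_family ({..<N} \<times> {..<d}) {..<k} w"
    unfolding w_def using orthonormal_family_tensor[OF orth_U orth_V] .
  have dist_R: "(frobenius_norm (outer_prod b c - R))\<^sup>2
      = (\<Sum>p\<in>{..<N} \<times> {..<d}. (b $ fst p * c $ snd p - (\<Sum>l<k. \<sigma> l * w l p))\<^sup>2)"
    if "b \<in> carrier_vec N" "c \<in> carrier_vec d" for b c
    unfolding frobenius_norm_diff_square[OF outer_prod_carrier[OF that] assms(4)]
    using that by (intro sum.cong refl) (auto simp: index_outer_prod R_index w_def)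
  have R_bar: "R_bar \<in> carrier_mat N d"
    unfolding assms(6) using U(1) V(1) by (intro mult_carrier_mat) auto
  have R_bar_index: "R_bar $$ (i, j) = \<sigma> 0 * U $$ (i, 0) * V $$ (j, 0)"
    if "i < N" "j < d" for i j
  proof -
    have "R_bar $$ (i, j) = (\<Sum>l<k. if l = 0 then \<sigma> 0 * U $$ (i, 0) * V $$ (j, 0) else 0)"
      unfolding assms(6) index_mult_mat_diag_transpose[OF U(1) V(1) that]
      by (intro sum.cong) auto
    then show ?thesis using k by simp
  qed
  \<comment> \<open>The truncation is a single rank-one term; its scalar \<open>\<sigma> 0\<close>
    is absorbed into the left vector.\<close>
  define b\<^sub>0 where "b\<^sub>0 = \<sigma> 0 \<cdot>\<^sub>v col U 0"
  define c\<^sub>0 where "c\<^sub>0 = col V 0"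
  have b\<^sub>0: "b\<^sub>0 \<in> carrier_vec N" and c\<^sub>0: "c\<^sub>0 \<in> carrier_vec d"
    using U(1) V(1) by (auto simp: b\<^sub>0_def c\<^sub>0_def)
  have R_bar_outer: "R_bar = outer_prod b\<^sub>0 c\<^sub>0"
  proof (rule eq_matI)
    show "R_bar $$ (i, j) = outer_prod b\<^sub>0 c\<^sub>0 $$ (i, j)"
      if "i < dim_row (outer_prod b\<^sub>0 c\<^sub>0)" "j < dim_col (outer_prod b\<^sub>0 c\<^sub>0)" for i j
      using that outer_prod_carrier[OF b\<^sub>0 c\<^sub>0] b\<^sub>0 c\<^sub>0 U(1) V(1) k
      by (simp add: R_bar_index index_outer_prod) (simp add: b\<^sub>0_def c\<^sub>0_def)
  qed (use R_bar outer_prod_carrier[OF b\<^sub>0 c\<^sub>0] in auto)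
  have dist_R_bar: "(frobenius_norm (R_bar - R))\<^sup>2 = (\<Sum>l<k. (\<sigma> l)\<^sup>2) - (\<sigma> 0)\<^sup>2"
  proof -
    \<comment> \<open>Subtracting \<open>R\<close> cancels the leading term, so the difference has
      coefficients \<open>- \<tau> l\<close>, and the expansion applies with \<open>f\<close> equal
      to zero.\<close>
    define \<tau> where "\<tau> l = (if l = 0 then 0 else \<sigma> l)" for l
    have split: "(\<Sum>l<k. h l) = h 0 + (\<Sum>l\<in>{..<k} - {0}. h l)" for h :: "nat \<Rightarrow> real"
      using k by (intro sum.remove) auto
    have "(frobenius_norm (R_bar - R))\<^sup>2
        = (\<Sum>p\<in>{..<N} \<times> {..<d}. (0 - (\<Sum>l<k. \<tau> l * w l p))\<^sup>2)"
      unfolding frobenius_norm_diff_square[OF R_bar assms(4)]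
      by (intro sum.cong refl) (auto simp: R_bar_index R_index w_def split \<tau>_def)
    also have "\<dots> = (\<Sum>l<k. (\<tau> l)\<^sup>2)"
      unfolding sum_square_diff_orthonormal[OF finite_lessThan orth_w] by simp
    also have "\<dots> = (\<Sum>l<k. (\<sigma> l)\<^sup>2) - (\<sigma> 0)\<^sup>2"
      unfolding split by (simp add: \<tau>_def)
    finally show ?thesis .
  qed
  have "(frobenius_norm (R_bar - R))\<^sup>2 \<le> (frobenius_norm (outer_prod b c - R))\<^sup>2"
    if bc: "b \<in> carrier_vec N" "c \<in> carrier_vec d" for b c
  proof -
    \<comment> \<open>\<open>t\<close> is the product of the Euclidean norms of \<open>b\<close> and
      \<open>c\<close>, hence the Frobenius norm of their outer product.\<close>
    define t where "t = L2_set (($) b) {..<N} * L2_set (($) c) {..<d}"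
    have inner: "(\<Sum>p\<in>{..<N} \<times> {..<d}. b $ fst p * c $ snd p * w l p)
        = (\<Sum>i<N. b $ i * U $$ (i, l)) * (\<Sum>j<d. c $ j * V $$ (j, l))" for l
      by (simp add: w_def sum_product sum.cartesian_product case_prod_unfold mult_ac)
    have "(\<Sum>p\<in>{..<N} \<times> {..<d}. (b $ fst p * c $ snd p)\<^sup>2) = t\<^sup>2"
      by (simp add: t_def L2_set_def power_mult_distrib sum_nonneg sum_product
          sum.cartesian_product case_prod_unfold)
    \<comment> \<open>The descending order makes \<open>\<sigma> 0\<close> a bound for all the
      weights.\<close>
    moreover have "(\<Sum>l<k. \<sigma> l * (\<Sum>p\<in>{..<N} \<times> {..<d}. b $ fst p * c $ snd p * w l p))
        \<le> \<sigma> 0 * t"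
      unfolding inner t_def
      using \<sigma>_mono \<sigma>_nonneg k by (intro weighted_coefficients_le orth_U orth_V) auto
    ultimately have "(frobenius_norm (outer_prod b c - R))\<^sup>2
        \<ge> t\<^sup>2 - 2 * (\<sigma> 0 * t) + (\<Sum>l<k. (\<sigma> l)\<^sup>2)"
      unfolding dist_R[OF bc] sum_square_diff_orthonormal[OF finite_lessThan orth_w] by simp
    \<comment> \<open>The bound is quadratic in \<open>t\<close>, with its minimum at
      \<open>t = \<sigma> 0\<close>, where it equals the distance of the truncation.\<close>
    moreover have "0 \<le> (t - \<sigma> 0)\<^sup>2" by simp
    ultimately show ?thesis
      unfolding dist_R_bar by (simp add: power2_diff mult_ac)
  qed
  with R_bar_outer b\<^sub>0 c\<^sub>0 show ?thesis by blast
qed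

end
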